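(* Let $(E,C)$ be a separated graph and $S\subseteq C_{\rm fin}$. If Assumption $( * )$ holds for $(E,C,S)$, then the monoid $M(E,C,S)$ is a refinement monoid.
   Context: A graph is a directed graph $E=(E^0,E^1,s,r)$ with $E^0$ a nonempty set (no finiteness or countability assumptions). A separated graph is a pair $(E,C)$ where $C=\bigsqcup_{v\in E^0}C_v$ and each $C_v$ is a partition of $s^{-1}(v)$ into pairwise disjoint nonempty subsets ($C_v=\emptyset$ if $v$ is a sink). $C_{\rm fin}$ denotes the set of finite members of $C$. For finite $Y\subseteq E^1$, $\mathbf r(Y):=\sum_{e\in Y}r(e)$ (in whichever monoid containing $E^0$ is under consideration). $M(E,C,S)$ is the abelian monoid with generators $E^0\sqcup\{q'_Z\mid Z\subseteq X\in C,\ 0<|Z|<\infty\}$ and relations: (1) $v=\mathbf r(Z)+q'_Z$ for $v\in E^0$, $Z\subseteq X\in C_v$, $0<|Z|<\infty$; (2) $q'_{Z_1}=\mathbf r(Z_2\setminus Z_1)+q'_{Z_2}$ for finite nonempty subsets $Z_1\subsetneq Z_2$ of $X\in C$; (3) $q'_X=0$ for $X\in S$. An abelian monoid is a refinement monoid if whenever $a+b=c+d$ there exist $x,y,z,t$ with $a=x+y$, $b=z+t$, $c=x+z$, $d=y+t$. Assumption $( * )$. For $v\in E^0$ let $\mathcal Z_v:=(C_v\cap C_{\rm fin})\sqcup\{\text{nonempty finite subsets of members of } C_v\setminus C_{\rm fin}\}$, and $\mathcal Z:=\bigsqcup_{v\in E^0}\mathcal Z_v$. Let $Q^0:=\{q'_Z\mid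 Z\in\mathcal Z\setminus S\}$ and let $F$ be the free abelian monoid on $E^0\sqcup Q^0$. In $F$ set $\boldsymbol\rho(Z):=\mathbf r(Z)$ if $Z\in S$, $\boldsymbol\rho(Z):=\mathbf r(Z)+q'_Z$ if $Z\in\mathcal Z\setminus S$, and $\boldsymbol\sigma(Z_1,Z_2):=\mathbf r(Z_2\setminus Z_1)+q'_{Z_2}$ for nonempty $Z_1\subsetneq Z_2$ in $\mathcal Z\setminus C_{\rm fin}$. For $\alpha,\beta\in F$ write $\alpha\rightsquigarrow_1\beta$ if $\alpha=\sum_{i=1}^k u_i+\sum_{i=k+1}^m u_i$ and $\beta=\sum_{i=1}^k r_i+\sum_{i=k+1}^m u_i$ for some $0\le k\le m$ and $u_i\in E^0\sqcup Q^0$ such that for each $i=1,\dots,k$ one of the following holds: (a) $u_i\in E^0$ is not a sink and $r_i=\boldsymbol\rho(Z_i)$ for some $Z_i\in\mathcal Z_{u_i}$; (b) $u_i=q'_{Z_i}\in Q^0$ for some $Z_i\in\mathcal Z\setminus C_{\rm fin}$ and $r_i=\boldsymbol\sigma(Z_i,Z_i')$ for some $Z_i'\in\mathcal Z$ with $Z_i\subsetneq Z_i'$. Assumption $( * )$ for $(E,C,S)$ states: for all $v\in E^0$ and $X,Y\in\mathcal Z_v$ such that $X\cup Y\notin\mathcal Z_v$, there exists $\gamma\in F$ such that $\boldsymbol\rho(X)\rightsquigarrow_1\gamma$ and $\boldsymbol\rho(Y)\rightsquigarrow_1\gamma$. *)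

theory Defs
  imports
    "HOL-Library.Multiset"
    "HOL-Library.Disjoint_Sets"
    "HOL-Algebra.Group"
    "Graph_Theory.Digraph"
begin

section \<open>Refinement monoids and presented abelian monoids\<close>

locale refinement_monoid = comm_monoid M for M (structure) +
  assumes refinement:
    "\<lbrakk>a \<in> carrier M; b \<in> carrier M; c \<in> carrier M; d \<in> carrier M; a \<otimes> b = c \<otimes> d\<rbrakk> \<Longrightarrow>
       \<exists>x \<in> carrier M. \<exists>y \<in> carrier M. \<exists>z \<in> carrier M. \<exists>t \<in> carrier M.
         a = x \<otimes> y \<and> b = z \<otimes> t \<and> c = x \<otimes> z \<and> d = y \<otimes> t"

text \<open>The free abelian monoid on a set \<open>A\<close> consists of the finite multisets supported in \<open>A\<close>.\<close>

definition free_carrier :: "'g set \<Rightarrow> 'g multiset set" where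
  "free_carrier A = {a. set_mset a \<subseteq> A}"

text \<open>The least congruence on the free abelian monoid on \<open>A\<close> that contains the relations \<open>R\<close>.\<close>

inductive_set presented_cong ::
  "'g set \<Rightarrow> ('g multiset \<times> 'g multiset) set \<Rightarrow> ('g multiset \<times> 'g multiset) set"
  for A :: "'g set" and R :: "('g multiset \<times> 'g multiset) set" where
  rel: "\<lbrakk>(a, b) \<in> R; a \<in> free_carrier A; b \<in> free_carrier A\<rbrakk> \<Longrightarrow> (a, b) \<in> presented_cong A R"
| refl: "a \<in> free_carrier A \<Longrightarrow> (a, a) \<in> presented_cong A R"
| sym: "(a, b) \<in> presented_cong A R \<Longrightarrow> (b, a) \<in> presented_cong A R"
| trans: "\<lbrakk>(a, b) \<in> presented_cong A R; (b, c) \<in> presented_cong A R\<rbrakk> \<Longrightarrow>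
    (a, c) \<in> presented_cong A R"
| add: "\<lbrakk>(a, b) \<in> presented_cong A R; c \<in> free_carrier A\<rbrakk> \<Longrightarrow>
    (a + c, b + c) \<in> presented_cong A R"

definition presented_monoid ::
  "'g set \<Rightarrow> ('g multiset \<times> 'g multiset) set \<Rightarrow> 'g multiset set monoid" where
  "presented_monoid A R =
    \<lparr>carrier = free_carrier A // presented_cong A R,
     mult = (\<lambda>x y. \<Union>a\<in>x. \<Union>b\<in>y. presented_cong A R `` {a + b}),
     one = presented_cong A R `` {{#}}\<rparr>"


section \<open>Separated graphs\<close>

text \<open>
  For an edge \<open>e\<close>, the source \<open>s(e)\<close> is \<^term>\<open>tail G e\<close> and the range \<open>r(e)\<close> is \<^term>\<open>head G e\<close>.
  The separation is given as the family of the sets \<open>C v\<close>; only its values at vertices of \<open>G\<close>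
  are relevant.
\<close>

locale separated_graph = wf_digraph G for G :: "('v, 'e) pre_digraph" +
  fixes C :: "'v \<Rightarrow> 'e set set"
  assumes verts_nonempty: "verts G \<noteq> {}"
    and partition: "v \<in> verts G \<Longrightarrow> partition_on (out_arcs G v) (C v)"

definition sep_all :: "('v, 'e) pre_digraph \<Rightarrow> ('v \<Rightarrow> 'e set set) \<Rightarrow> 'e set set" where
  "sep_all G C = (\<Union>v\<in>verts G. C v)"

definition sep_fin :: "('v, 'e) pre_digraph \<Rightarrow> ('v \<Rightarrow> 'e set set) \<Rightarrow> 'e set set" where
  "sep_fin G C = {X \<in> sep_all G C. finite X}"

text \<open>\<open>Q Z\<close> is the symbol \<open>q'\<^sub>Z\<close>.\<close>

datatype ('v, 'e) gen = Vert 'v | Q "'e set"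

definition range_sum :: "('v, 'e) pre_digraph \<Rightarrow> 'e set \<Rightarrow> ('v, 'e) gen multiset" where
  "range_sum G Y = (\<Sum>e\<in>Y. {#Vert (head G e)#})"


section \<open>The monoid \<open>M(E,C,S)\<close>\<close>

definition M_gens :: "('v, 'e) pre_digraph \<Rightarrow> ('v \<Rightarrow> 'e set set) \<Rightarrow> ('v, 'e) gen set" where
  "M_gens G C =
    Vert ` verts G \<union> {Q Z | Z X. X \<in> sep_all G C \<and> Z \<subseteq> X \<and> finite Z \<and> Z \<noteq> {}}"

definition M_rels ::
  "('v, 'e) pre_digraph \<Rightarrow> ('v \<Rightarrow> 'e set set) \<Rightarrow> 'e set set \<Rightarrow>
    (('v, 'e) gen multiset \<times> ('v, 'e) gen multiset) set" where
  "M_rels G C S =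
    {({#Vert v#}, range_sum G Z + {#Q Z#}) | v X Z.
       v \<in> verts G \<and> X \<in> C v \<and> Z \<subseteq> X \<and> finite Z \<and> Z \<noteq> {}} \<union>
    {({#Q Z1#}, range_sum G (Z2 - Z1) + {#Q Z2#}) | X Z1 Z2.
       X \<in> sep_all G C \<and> Z1 \<noteq> {} \<and> Z1 \<subset> Z2 \<and> Z2 \<subseteq> X \<and> finite Z2} \<union>
    {({#Q X#}, {#}) | X. X \<in> S}"

definition M_monoid ::
  "('v, 'e) pre_digraph \<Rightarrow> ('v \<Rightarrow> 'e set set) \<Rightarrow> 'e set set \<Rightarrow>
    ('v, 'e) gen multiset set monoid" where
  "M_monoid G C S = presented_monoid (M_gens G C) (M_rels G C S)"


section \<open>Assumption (*)\<close>

definition ZZ_at :: "('v, 'e) pre_digraph \<Rightarrow> ('v \<Rightarrow> 'e set set) \<Rightarrow> 'v \<Rightarrow> 'e set set" where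
  "ZZ_at G C v =
    (C v \<inter> sep_fin G C) \<union> {Z. \<exists>X \<in> C v - sep_fin G C. Z \<subseteq> X \<and> finite Z \<and> Z \<noteq> {}}"

definition ZZ :: "('v, 'e) pre_digraph \<Rightarrow> ('v \<Rightarrow> 'e set set) \<Rightarrow> 'e set set" where
  "ZZ G C = (\<Union>v\<in>verts G. ZZ_at G C v)"

text \<open>The generating set \<open>E\<^sup>0 \<squnion> Q\<^sup>0\<close> of the free abelian monoid \<open>F\<close>.\<close>

definition F_gens ::
  "('v, 'e) pre_digraph \<Rightarrow> ('v \<Rightarrow> 'e set set) \<Rightarrow> 'e set set \<Rightarrow> ('v, 'e) gen set" where
  "F_gens G C S = Vert ` verts G \<union> Q ` (ZZ G C - S)"

definition rho ::
  "('v, 'e) pre_digraph \<Rightarrow> 'e set set \<Rightarrow> 'e set \<Rightarrow> ('v, 'e) gen multiset" where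
  "rho G S Z = (if Z \<in> S then range_sum G Z else range_sum G Z + {#Q Z#})"

definition sigma ::
  "('v, 'e) pre_digraph \<Rightarrow> 'e set \<Rightarrow> 'e set \<Rightarrow> ('v, 'e) gen multiset" where
  "sigma G Z1 Z2 = range_sum G (Z2 - Z1) + {#Q Z2#}"

definition elem_step ::
  "('v, 'e) pre_digraph \<Rightarrow> ('v \<Rightarrow> 'e set set) \<Rightarrow> 'e set set \<Rightarrow>
    ('v, 'e) gen \<Rightarrow> ('v, 'e) gen multiset \<Rightarrow> bool" where
  "elem_step G C S u w \<longleftrightarrow>
    (\<exists>v \<in> verts G. u = Vert v \<and> out_arcs G v \<noteq> {} \<and> (\<exists>Z \<in> ZZ_at G C v. w = rho G S Z)) \<or>
    (\<exists>Z \<in> ZZ G C - sep_fin G C. u = Q Z \<and> (\<exists>Z' \<in> ZZ G C. Z \<subset> Z' \<and> w = sigma G Z Z'))"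

definition leadsto1 ::
  "('v, 'e) pre_digraph \<Rightarrow> ('v \<Rightarrow> 'e set set) \<Rightarrow> 'e set set \<Rightarrow>
    ('v, 'e) gen multiset \<Rightarrow> ('v, 'e) gen multiset \<Rightarrow> bool" where
  "leadsto1 G C S \<alpha> \<beta> \<longleftrightarrow>
    (\<exists>(k::nat) (m::nat) u w. k \<le> m \<and>
       (\<forall>i \<in> {1..m}. u i \<in> F_gens G C S) \<and>
       (\<forall>i \<in> {1..k}. elem_step G C S (u i) (w i)) \<and>
       \<alpha> = (\<Sum>i = 1..k. {#u i#}) + (\<Sum>i = k+1..m. {#u i#}) \<and>
       \<beta> = (\<Sum>i = 1..k. w i) + (\<Sum>i = k+1..m. {#u i#}))"

definition assumption_star ::
  "('v, 'e) pre_digraph \<Rightarrow> ('v \<Rightarrow> 'e set set) \<Rightarrow> 'e set set \<Rightarrow> bool" where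
  "assumption_star G C S \<longleftrightarrow>
    (\<forall>v \<in> verts G. \<forall>X \<in> ZZ_at G C v. \<forall>Y \<in> ZZ_at G C v. X \<union> Y \<notin> ZZ_at G C v \<longrightarrow>
       (\<exists>\<gamma> \<in> free_carrier (F_gens G C S).
          leadsto1 G C S (rho G S X) \<gamma> \<and> leadsto1 G C S (rho G S Y) \<gamma>))"

end

theory Submission
  imports Defs "HOL-Library.Confluence"
begin

text \<open>
  A free abelian monoid is a refinement monoid: two decompositions of one multiset have a
  common refinement. The proof transports this to \<open>M(E,C,S)\<close> by rewriting.

  When \<open>Z\<close> is a proper subset of a finite \<open>X \<in> C\<close>, or \<open>Z \<in> S\<close>, the generator \<open>q'\<^sub>Z\<close> can be
  expressed by other generators: it equals \<open>r(X \<setminus> Z) + q'\<^sub>X\<close>, and \<open>q'\<^sub>X = 0\<close> for \<open>X \<in> S\<close>. Substituting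
  these expressions (\<open>reduce\<close>) turns every defining relation either into an identity or into an
  instance of one of the replacements \<open>v \<leadsto> \<rho>(Z)\<close>, \<open>q'\<^sub>Z \<leadsto> \<sigma>(Z,Z')\<close> that generate \<open>\<leadsto>\<^sub>1\<close>. Hence
  congruent elements have reductions that are connected by a zigzag of parallel replacements
  (\<open>cong_imp_convertible\<close>), and conversely reductions and replacements stay within the congruence
  class (\<open>reduce_cong\<close>, \<open>parallel_star_cong\<close>).

  Parallel replacement has the diamond property as soon as any two replacements of a single
  generator can be joined in one parallel step (\<open>parallel_diamond\<close>). Here this holds
  (\<open>elem_step_joinable\<close>): two replacements that use subsets \<open>X\<close>, \<open>Y\<close> of the same infinite member
  of \<open>C\<close> are both continued by enlarging to \<open>X \<union> Y\<close>, and for replacements of a vertex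
  at which \<open>X \<union> Y\<close> is not available, Assumption (*) is exactly the joinability required.

  So if \<open>a + b\<close> and \<open>c + d\<close> are congruent, then \<open>reduce a + reduce b\<close> and \<open>reduce c + reduce d\<close>
  rewrite to a common \<open>e\<close>. Each generator is replaced independently of the others, so \<open>e\<close> splits as
  \<open>a' + b'\<close> and as \<open>c' + d'\<close> with \<open>a'\<close>, \<open>b'\<close>, \<open>c'\<close>, \<open>d'\<close> congruent to \<open>a\<close>, \<open>b\<close>, \<open>c\<close>, \<open>d\<close>
  (\<open>parallel_star_split\<close>). A common refinement of these two decompositions in the free monoid
  is the desired one in \<open>M(E,C,S)\<close>.
\<close>


section \<open>Presented abelian monoids\<close>

lemma free_carrier_empty [simp]: "{#} \<in> free_carrier A"
  by (simp add: free_carrier_def)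

lemma free_carrier_add_iff [simp]:
  "a + b \<in> free_carrier A \<longleftrightarrow> a \<in> free_carrier A \<and> b \<in> free_carrier A"
  by (auto simp: free_carrier_def)

lemma free_carrier_add_mset_iff [simp]:
  "add_mset u a \<in> free_carrier A \<longleftrightarrow> u \<in> A \<and> a \<in> free_carrier A"
  by (auto simp: free_carrier_def)

lemma presented_cong_carrier:
  assumes "(a, b) \<in> presented_cong A R"
  shows "a \<in> free_carrier A" "b \<in> free_carrier A"
  using assms by (induction rule: presented_cong.induct) auto

lemma equiv_presented_cong: "equiv (free_carrier A) (presented_cong A R)"
proof (rule equivI)
  show "presented_cong A R \<subseteq> free_carrier A \<times> free_carrier A"
    by (auto dest: presented_cong_carrier)
  show "refl_on (free_carrier A) (presented_cong A R)"
    by (simp add: refl_on_def presented_cong.refl)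
  show "sym (presented_cong A R)"
    by (meson symI presented_cong.sym)
  show "trans (presented_cong A R)"
    by (meson transI presented_cong.trans)
qed

lemma presented_cong_plus:
  assumes "(a, b) \<in> presented_cong A R" "(c, d) \<in> presented_cong A R"
  shows "(a + c, b + d) \<in> presented_cong A R"
proof -
  have "(a + c, b + c) \<in> presented_cong A R"
    using assms by (blast intro: presented_cong.add dest: presented_cong_carrier)
  moreover have "(c + b, d + b) \<in> presented_cong A R"
    using assms by (blast intro: presented_cong.add dest: presented_cong_carrier)
  ultimately show ?thesis
    by (metis add.commute presented_cong.trans)
qed

lemma mult_presented_monoid:
  assumes "a \<in> free_carrier A" "b \<in> free_carrier A"
  shows "presented_cong A R `` {a} \<otimes>\<^bsub>presented_monoid A R\<^esub> presented_cong A R `` {b}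
    = presented_cong A R `` {a + b}"
proof -
  have "congruent2 (presented_cong A R) (presented_cong A R)
      (\<lambda>a b. presented_cong A R `` {a + b})"
  proof (rule congruent2I')
    fix a a' b b'
    assume "(a, a') \<in> presented_cong A R" "(b, b') \<in> presented_cong A R"
    then show "presented_cong A R `` {a + b} = presented_cong A R `` {a' + b'}"
      by (intro equiv_class_eq[OF equiv_presented_cong] presented_cong_plus)
  qed
  then show ?thesis
    using UN_equiv_class2[OF equiv_presented_cong equiv_presented_cong _ assms]
    by (simp add: presented_monoid_def)
qed

lemma presented_monoid_carrierE:
  assumes "x \<in> carrier (presented_monoid A R)"
  obtains a where "a \<in> free_carrier A" "x = presented_cong A R `` {a}"
  using assms by (auto simp: presented_monoid_def elim!: quotientE)

lemma presented_class_in_carrier: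
  "a \<in> free_carrier A \<Longrightarrow> presented_cong A R `` {a} \<in> carrier (presented_monoid A R)"
  by (simp add: presented_monoid_def quotientI)

lemma one_presented_monoid: "\<one>\<^bsub>presented_monoid A R\<^esub> = presented_cong A R `` {{#}}"
  by (simp add: presented_monoid_def)

lemma presented_class_eq_iff:
  assumes "a \<in> free_carrier A" "b \<in> free_carrier A"
  shows "presented_cong A R `` {a} = presented_cong A R `` {b} \<longleftrightarrow> (a, b) \<in> presented_cong A R"
  using eq_equiv_class_iff[OF equiv_presented_cong assms] .

lemma comm_monoid_presented_monoid: "comm_monoid (presented_monoid A R)"
proof (rule comm_monoidI)
  show "\<one>\<^bsub>presented_monoid A R\<^esub> \<in> carrier (presented_monoid A R)"
    by (simp add: one_presented_monoid presented_class_in_carrier)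
qed (auto elim!: presented_monoid_carrierE
      simp: mult_presented_monoid presented_class_in_carrier one_presented_monoid add_ac)

text \<open>
  Refinement can be checked on representatives. The congruence relates only elements of the
  free monoid on \<open>A\<close>, so membership in that monoid is implicit here.
\<close>

lemma refinement_monoid_presented_monoid:
  assumes refine: "\<And>a b c d. (a + b, c + d) \<in> presented_cong A R \<Longrightarrow>
    \<exists>x y z t. (a, x + y) \<in> presented_cong A R \<and> (b, z + t) \<in> presented_cong A R \<and>
      (c, x + z) \<in> presented_cong A R \<and> (d, y + t) \<in> presented_cong A R"
  shows "refinement_monoid (presented_monoid A R)"
proof (intro refinement_monoid.intro refinement_monoid_axioms.intro comm_monoid_presented_monoid)
  let ?M = "presented_monoid A R" and ?cl = "\<lambda>a. presented_cong A R `` {a}"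
  fix p q r s
  assume "p \<in> carrier ?M" "q \<in> carrier ?M" "r \<in> carrier ?M" "s \<in> carrier ?M"
  then obtain a b c d where
    abcd: "a \<in> free_carrier A" "b \<in> free_carrier A" "c \<in> free_carrier A" "d \<in> free_carrier A"
    and pqrs: "p = ?cl a" "q = ?cl b" "r = ?cl c" "s = ?cl d"
    by (metis presented_monoid_carrierE)
  assume "p \<otimes>\<^bsub>?M\<^esub> q = r \<otimes>\<^bsub>?M\<^esub> s"
  then have "(a + b, c + d) \<in> presented_cong A R"
    using abcd pqrs by (simp add: mult_presented_monoid presented_class_eq_iff)
  then obtain x y z t where
    xyzt: "(a, x + y) \<in> presented_cong A R" "(b, z + t) \<in> presented_cong A R"
      "(c, x + z) \<in> presented_cong A R" "(d, y + t) \<in> presented_cong A R"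
    using refine by blast
  then have car: "x \<in> free_carrier A" "y \<in> free_carrier A" "z \<in> free_carrier A" "t \<in> free_carrier A"
    by (auto dest: presented_cong_carrier)
  with xyzt abcd have
    "p = ?cl x \<otimes>\<^bsub>?M\<^esub> ?cl y \<and> q = ?cl z \<otimes>\<^bsub>?M\<^esub> ?cl t \<and>
     r = ?cl x \<otimes>\<^bsub>?M\<^esub> ?cl z \<and> s = ?cl y \<otimes>\<^bsub>?M\<^esub> ?cl t"
    unfolding pqrs by (simp add: mult_presented_monoid presented_class_eq_iff)
  with car show "\<exists>x\<in>carrier ?M. \<exists>y\<in>carrier ?M. \<exists>z\<in>carrier ?M. \<exists>t\<in>carrier ?M.
      p = x \<otimes>\<^bsub>?M\<^esub> y \<and> q = z \<otimes>\<^bsub>?M\<^esub> t \<and> r = x \<otimes>\<^bsub>?M\<^esub> z \<and> s = y \<otimes>\<^bsub>?M\<^esub> t"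
    by (intro bexI[of _ "?cl x"] bexI[of _ "?cl y"] bexI[of _ "?cl z"] bexI[of _ "?cl t"]
        presented_class_in_carrier)
qed

text \<open>
  The part common to \<open>a\<close> and \<open>c\<close> may be taken as large as possible; the other three parts
  are then forced.
\<close>

lemma multiset_refinement:
  fixes a b c d :: "'g multiset"
  assumes "a + b = c + d"
  obtains x y z t where "a = x + y" "b = z + t" "c = x + z" "d = y + t"
proof
  show "a = a \<inter># c + (a - c)" "c = a \<inter># c + (c - a)"
    by (auto simp: multiset_eq_iff)
  have cnt: "count a u + count b u = count c u + count d u" for u
    using assms by (metis count_union)
  show "b = (c - a) + (b - (c - a))" "d = (a - c) + (b - (c - a))"
  proof (safe intro!: multiset_eqI)
    fix u
    show "count b u = count (c - a + (b - (c - a))) u"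
      and "count d u = count (a - c + (b - (c - a))) u"
      using cnt[of u] by simp_all
  qed
qed


section \<open>Parallel replacement of generators\<close>

text \<open>
  This is the relation \<open>\<leadsto>\<^sub>1\<close> for an arbitrary set \<open>E\<close> of replacement rules, presented inductively
  over the generators instead of by an enumeration of them. Any generator whatsoever may be
  kept, which makes the relation reflexive on all multisets; rewriting that starts in the free
  monoid of interest never sees the difference.
\<close>

inductive parallel :: "('g \<Rightarrow> 'g multiset \<Rightarrow> bool) \<Rightarrow> 'g multiset \<Rightarrow> 'g multiset \<Rightarrow> bool"
  for E :: "'g \<Rightarrow> 'g multiset \<Rightarrow> bool" where
  empty: "parallel E {#} {#}"
| keep: "parallel E a b \<Longrightarrow> parallel E (add_mset u a) (add_mset u b)"
| replace: "E u w \<Longrightarrow> parallel E a b \<Longrightarrow> parallel E (add_mset u a) (w + b)"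

lemma parallel_refl: "parallel E a a"
  by (induction a) (auto intro: parallel.intros)

lemma parallel_gen: "E u w \<Longrightarrow> parallel E {#u#} w"
  using parallel.replace[OF _ parallel.empty] by fastforce

lemma parallel_add: "parallel E a b \<Longrightarrow> parallel E c d \<Longrightarrow> parallel E (a + c) (b + d)"
  by (induction rule: parallel.induct) (auto intro: parallel.intros simp: add.assoc)

lemma add_mset_eq_plusE:
  assumes "add_mset u a = b + c"
  obtains b' where "b = add_mset u b'" "a = b' + c"
    | c' where "c = add_mset u c'" "a = b + c'"
proof -
  have "u \<in># b \<or> u \<in># c"
    using assms by (metis union_iff union_single_eq_member)
  then show thesis
    using assms that by (auto dest!: multi_member_split)
qed

text \<open>
  Every replacement starts from a single generator, so a step from a sum is a sum of steps.
  This is what lets a decomposition of an element be followed through a rewriting sequence.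
\<close>

lemma parallel_split:
  assumes "parallel E a (b :: 'g multiset)" "a = a1 + a2"
  shows "\<exists>b1 b2. b = b1 + b2 \<and> parallel E a1 b1 \<and> parallel E a2 b2"
  using assms
proof (induction arbitrary: a1 a2 rule: parallel.induct)
  case empty
  then show ?case by (auto intro: parallel.empty)
next
  case (keep a b u)
  from keep.prems show ?case
  proof (cases rule: add_mset_eq_plusE)
    case (1 a1')
    with keep.IH[of a1' a2] show ?thesis
      by (metis parallel.keep union_mset_add_mset_left)
  next
    case (2 a2')
    with keep.IH[of a1 a2'] show ?thesis
      by (metis parallel.keep union_mset_add_mset_right)
  qed
next
  case (replace u w a b)
  from replace.prems show ?case
  proof (cases rule: add_mset_eq_plusE)
    case (1 a1')
    with replace.IH[of a1' a2] replace.hyps(1) show ?thesis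
      by (metis parallel.replace add.assoc)
  next
    case (2 a2')
    with replace.IH[of a1 a2'] replace.hyps(1) show ?thesis
      by (metis parallel.replace add.left_commute)
  qed
qed

lemma parallel_star_split:
  assumes "(parallel E)\<^sup>*\<^sup>* (a1 + a2) b"
  shows "\<exists>b1 b2. b = b1 + b2 \<and> (parallel E)\<^sup>*\<^sup>* a1 b1 \<and> (parallel E)\<^sup>*\<^sup>* a2 b2"
  using assms
proof (induction rule: rtranclp_induct)
  case base
  then show ?case by blast
next
  case (step b c)
  then obtain b1 b2 where "b = b1 + b2" "(parallel E)\<^sup>*\<^sup>* a1 b1" "(parallel E)\<^sup>*\<^sup>* a2 b2"
    by blast
  moreover from this step.hyps(2) obtain c1 c2 where
    "c = c1 + c2" "parallel E b1 c1" "parallel E b2 c2"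
    using parallel_split by blast
  ultimately show ?case
    by (blast intro: rtranclp.rtrancl_into_rtrancl)
qed

inductive_cases parallel_emptyE: "parallel E {#} b"

lemma parallel_singleE:
  assumes "parallel E {#u#} b"
  obtains "b = {#u#}" | "E u b"
proof -
  from assms have "b = {#u#} \<or> E u b"
    by cases (auto elim: parallel_emptyE)
  then show thesis using that by blast
qed

text \<open>
  A multiset is rewritten generator by generator, so joining the two results over each
  generator, in one parallel step, joins the two sums. Closing the square by one step on each
  side, rather than by sequences, is essential: rewriting need not terminate, so local
  confluence alone would not give confluence.
\<close>

lemma parallel_diamond:
  assumes local: "\<And>u w1 w2. E u w1 \<Longrightarrow> E u w2 \<Longrightarrow> \<exists>w. parallel E w1 w \<and> parallel E w2 w"
    and "parallel E a b" "parallel E a c"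
  shows "\<exists>d. parallel E b d \<and> parallel E c d"
  using assms(2,3)
proof (induction a arbitrary: b c)
  case empty
  then show ?case by (blast elim: parallel_emptyE intro: parallel.empty)
next
  case (add u a)
  have plus: "add_mset u a = {#u#} + a" by simp
  obtain b1 b2 where b: "b = b1 + b2" "parallel E {#u#} b1" "parallel E a b2"
    using parallel_split[OF add.prems(1) plus] by blast
  obtain c1 c2 where c: "c = c1 + c2" "parallel E {#u#} c1" "parallel E a c2"
    using parallel_split[OF add.prems(2) plus] by blast
  have "\<exists>d. parallel E b1 d \<and> parallel E c1 d"
    using b(2)
  proof (cases rule: parallel_singleE)
    case 1
    with c(2) parallel_refl show ?thesis by blast
  next
    case b1: 2
    from c(2) show ?thesis
    proof (cases rule: parallel_singleE)
      case 1
      with b(2) parallel_refl show ?thesis by blast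
    next
      case 2
      with b1 show ?thesis by (rule local)
    qed
  qed
  with add.IH[OF b(3) c(3)] b(1) c(1) show ?case
    by (metis parallel_add)
qed

text \<open>
  The diamond property implies confluence, and in a confluent system every zigzag can be
  replaced by a descent from both ends to a common element.
\<close>

lemma parallel_church_rosser:
  assumes "\<And>u w1 w2. E u w1 \<Longrightarrow> E u w2 \<Longrightarrow> \<exists>w. parallel E w1 w \<and> parallel E w2 w"
    and "equivclp (parallel E) a b"
  shows "\<exists>c. (parallel E)\<^sup>*\<^sup>* a c \<and> (parallel E)\<^sup>*\<^sup>* b c"
proof -
  have "strong_confluentp (parallel E)"
  proof
    fix x y z
    assume "parallel E x y" "parallel E x z"
    then have "\<exists>u. parallel E y u \<and> parallel E z u"
      by (rule parallel_diamond[where E = E, rotated]) (rule assms(1))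
    then show "\<exists>u. (parallel E)\<^sup>*\<^sup>* y u \<and> (parallel E)\<^sup>=\<^sup>= z u"
      by blast
  qed
  then have "((parallel E)\<^sup>*\<^sup>* OO (parallel E)\<inverse>\<inverse>\<^sup>*\<^sup>*) a b"
    using assms(2) semiconfluentp_equivclp[OF strong_confluentp_into_semiconfluentp] by metis
  then show ?thesis
    by (auto simp: rtranclp_conversep)
qed

lemma parallel_convertible_add:
  assumes "equivclp (parallel E) a b"
  shows "equivclp (parallel E) (a + c) (b + c)"
  using assms
proof (induction rule: equivclp_induct)
  case base
  then show ?case by simp
next
  case (step y z)
  then have "parallel E (y + c) (z + c) \<or> parallel E (z + c) (y + c)"
    by (blast intro: parallel_add parallel_refl)
  then have "equivclp (parallel E) (y + c) (z + c)"
    by blast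
  with step.IH show ?case
    by (meson transp_equivclp transpD)
qed

lemma leadsto1_imp_parallel:
  assumes "leadsto1 G C S a b"
  shows "parallel (elem_step G C S) a b"
proof -
  let ?E = "elem_step G C S"
  obtain k m :: nat and u w where steps: "\<forall>i\<in>{1..k}. ?E (u i) (w i)"
    and a: "a = (\<Sum>i = 1..k. {#u i#}) + (\<Sum>i = k+1..m. {#u i#})"
    and b: "b = (\<Sum>i = 1..k. w i) + (\<Sum>i = k+1..m. {#u i#})"
    using assms unfolding leadsto1_def by blast
  have "parallel ?E (\<Sum>i\<in>I. {#u i#}) (\<Sum>i\<in>I. w i)" if "finite I" "I \<subseteq> {1..k}" for I
    using that
  proof (induction rule: finite_induct)
    case empty
    then show ?case by (simp add: parallel.empty)
  next
    case (insert i I)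
    then have "parallel ?E {#u i#} (w i)"
      using steps by (blast intro: parallel_gen)
    with insert show ?case
      using parallel_add by fastforce
  qed
  then show ?thesis
    unfolding a b by (intro parallel_add parallel_refl) auto
qed


section \<open>Members of the separation\<close>

locale finitely_marked_separated_graph = separated_graph G C
  for G :: "('v, 'e) pre_digraph" and C :: "'v \<Rightarrow> 'e set set" +
  fixes S :: "'e set set"
  assumes S_sub: "S \<subseteq> sep_fin G C"
begin

abbreviation cong (infix "\<approx>" 50) where
  "a \<approx> b \<equiv> (a, b) \<in> presented_cong (M_gens G C) (M_rels G C S)"

lemma member_C:
  assumes "v \<in> verts G" "X \<in> C v"
  shows "X \<subseteq> out_arcs G v" "X \<noteq> {}"
  using partition[OF assms(1)] assms(2) by (auto simp: partition_on_def)

lemma same_vertex: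
  assumes "v \<in> verts G" "X \<in> C v" "w \<in> verts G" "Y \<in> C w" "e \<in> X" "e \<in> Y"
  shows "v = w"
  using member_C(1)[OF assms(1,2)] member_C(1)[OF assms(3,4)] assms(5,6) by (auto simp: out_arcs_def)

text \<open>
  Members of \<open>C\<close> at different vertices are disjoint as well, since an edge determines its source.
  So a nonempty set of edges lies in at most one member of \<open>C\<close>; this is what makes the
  substitution for \<open>q'\<^sub>Z\<close> unambiguous and keeps the finite and infinite members apart.
\<close>

lemma unique_member:
  assumes "X \<in> sep_all G C" "Y \<in> sep_all G C" "e \<in> X" "e \<in> Y"
  shows "X = Y"
proof -
  obtain v w where vw: "v \<in> verts G" "X \<in> C v" "w \<in> verts G" "Y \<in> C w"
    using assms by (auto simp: sep_all_def)
  then have "v = w" using same_vertex assms(3,4) by blast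
  then have "disjoint (C v)" "X \<in> C v" "Y \<in> C v"
    using vw partition[of v] by (auto simp: partition_on_def)
  then show ?thesis
    using assms(3,4) by (auto simp: disjoint_def)
qed

lemma ZZ_at_cases:
  assumes "v \<in> verts G" "Z \<in> ZZ_at G C v"
  obtains X where "X \<in> C v" "X \<in> sep_all G C" "Z \<subseteq> X" "finite Z" "Z \<noteq> {}" "X \<in> sep_fin G C \<longrightarrow> Z = X"
  using assms member_C(2)[OF assms(1)]
  by (auto simp: ZZ_at_def sep_fin_def sep_all_def)

lemma head_in_verts:
  assumes "X \<in> sep_all G C" "e \<in> X"
  shows "head G e \<in> verts G"
  using assms member_C(1) by (fastforce simp: sep_all_def)

lemma range_sum_in_free:
  assumes "X \<in> sep_all G C" "Z \<subseteq> X"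
  shows "range_sum G Z \<in> free_carrier (M_gens G C)"
proof (cases "finite Z")
  case True
  then show ?thesis using assms(2)
    by (induction rule: finite_induct)
      (auto simp: range_sum_def M_gens_def head_in_verts[OF assms(1)])
qed (simp add: range_sum_def)

lemma Q_in_gens:
  "X \<in> sep_all G C \<Longrightarrow> Z \<subseteq> X \<Longrightarrow> finite Z \<Longrightarrow> Z \<noteq> {} \<Longrightarrow> Q Z \<in> M_gens G C"
  by (auto simp: M_gens_def)

lemma range_sum_diff:
  assumes "finite Z2" "Z0 \<subseteq> Z1" "Z1 \<subseteq> Z2"
  shows "range_sum G (Z1 - Z0) + range_sum G (Z2 - Z1) = range_sum G (Z2 - Z0)"
proof -
  have "Z2 - Z0 = (Z1 - Z0) \<union> (Z2 - Z1)" using assms by auto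
  moreover have "finite (Z1 - Z0)" "finite (Z2 - Z1)"
    using assms finite_subset[of Z1 Z2] by auto
  moreover have "(Z1 - Z0) \<inter> (Z2 - Z1) = {}" by auto
  ultimately show ?thesis
    unfolding range_sum_def by (simp only: sum.union_disjoint)
qed

lemmas range_sum_diff_empty = range_sum_diff[where ?Z0.0 = "{}", simplified]



section \<open>Eliminating redundant generators\<close>

text \<open>
  The value of \<open>q'\<^sub>X\<close> after imposing \<open>q'\<^sub>X = 0\<close> for \<open>X \<in> S\<close>.
\<close>

definition residue :: "'e set \<Rightarrow> ('v, 'e) gen multiset" where
  "residue X = (if X \<in> S then {#} else {#Q X#})"

text \<open>
  For nonempty \<open>Z\<close> there is at most one such \<open>X\<close>, by \<open>unique_member\<close>.
\<close>

definition completion :: "'e set \<Rightarrow> 'e set" where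
  "completion Z = (THE X. X \<in> sep_fin G C \<and> Z \<subseteq> X)"

text \<open>
  The substitution that eliminates the generators \<open>q'\<^sub>Z\<close> not belonging to \<open>Q\<^sup>0\<close>. Those in \<open>Q\<^sup>0\<close>
  are fixed: if \<open>Z\<close> is itself a finite member outside \<open>S\<close>, the formula gives \<open>r(\<emptyset>) + q'\<^sub>Z\<close>.
\<close>

fun reduce_gen :: "('v, 'e) gen \<Rightarrow> ('v, 'e) gen multiset" where
  "reduce_gen (Vert v) = {#Vert v#}"
| "reduce_gen (Q Z) =
    (if \<exists>X\<in>sep_fin G C. Z \<subseteq> X
     then range_sum G (completion Z - Z) + residue (completion Z)
     else {#Q Z#})"

definition reduce :: "('v, 'e) gen multiset \<Rightarrow> ('v, 'e) gen multiset" where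
  "reduce a = (\<Sum>u\<in>#a. reduce_gen u)"

lemma reduce_simps [simp]:
  "reduce {#} = {#}"
  "reduce (add_mset u a) = reduce_gen u + reduce a"
  "reduce (a + b) = reduce a + reduce b"
  by (simp_all add: reduce_def)

lemma reduce_range_sum [simp]: "reduce (range_sum G Z) = range_sum G Z"
proof (cases "finite Z")
  case True
  then show ?thesis
    by (induction rule: finite_induct) (simp_all add: range_sum_def)
qed (simp add: range_sum_def)

lemma rho_residue: "rho G S Z = range_sum G Z + residue Z"
  by (simp add: rho_def residue_def)

lemma reduce_gen_finite:
  assumes "X \<in> sep_fin G C" "Z \<subseteq> X" "Z \<noteq> {}"
  shows "reduce_gen (Q Z) = range_sum G (X - Z) + residue X"
proof -
  have "completion Z = X"
    unfolding completion_def
  proof (rule the_equality)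
    fix Y assume "Y \<in> sep_fin G C \<and> Z \<subseteq> Y"
    then show "Y = X"
      using assms unique_member[of Y X] by (fastforce simp: sep_fin_def)
  qed (use assms in simp)
  then show ?thesis
    using assms by auto
qed

lemma reduce_gen_infinite:
  assumes "X \<in> sep_all G C" "X \<notin> sep_fin G C" "Z \<subseteq> X" "Z \<noteq> {}"
  shows "reduce_gen (Q Z) = {#Q Z#}"
proof -
  have "\<not> (\<exists>Y\<in>sep_fin G C. Z \<subseteq> Y)"
    using assms unique_member[of X] by (fastforce simp: sep_fin_def)
  then show ?thesis by simp
qed

lemma subset_infinite_notin_S:
  assumes "X \<in> sep_all G C" "X \<notin> sep_fin G C" "Z \<subseteq> X" "Z \<noteq> {}"
  shows "Z \<notin> sep_fin G C" "Z \<notin> S"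
proof -
  show "Z \<notin> sep_fin G C"
    using assms unique_member[of X Z] by (fastforce simp: sep_fin_def)
  then show "Z \<notin> S" using S_sub by blast
qed

lemma ZZ_at_fin: "X \<in> C v \<Longrightarrow> X \<in> sep_fin G C \<Longrightarrow> X \<in> ZZ_at G C v"
  by (simp add: ZZ_at_def)

lemma ZZ_at_infinite:
  "X \<in> C v \<Longrightarrow> X \<notin> sep_fin G C \<Longrightarrow> Z \<subseteq> X \<Longrightarrow> finite Z \<Longrightarrow> Z \<noteq> {} \<Longrightarrow> Z \<in> ZZ_at G C v"
  by (auto simp: ZZ_at_def)

lemma ZZ_infinite:
  assumes "X \<in> sep_all G C" "X \<notin> sep_fin G C" "Z \<subseteq> X" "finite Z" "Z \<noteq> {}"
  shows "Z \<in> ZZ G C"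
proof -
  obtain v where "v \<in> verts G" "X \<in> C v"
    using assms(1) by (auto simp: sep_all_def)
  then show ?thesis
    using ZZ_at_infinite[OF _ assms(2-5)] by (auto simp: ZZ_def)
qed

lemma elem_step_Vert:
  assumes "v \<in> verts G" "Z \<in> ZZ_at G C v"
  shows "elem_step G C S (Vert v) (rho G S Z)"
proof -
  obtain X where "X \<in> C v" "Z \<subseteq> X" "Z \<noteq> {}"
    using ZZ_at_cases[OF assms] by metis
  then have "out_arcs G v \<noteq> {}"
    using member_C(1)[OF assms(1)] by blast
  then show ?thesis
    using assms by (auto simp: elem_step_def)
qed

lemma elem_step_Q:
  assumes "X \<in> sep_all G C" "X \<notin> sep_fin G C" "Z \<noteq> {}" "Z \<subset> Z'" "Z' \<subseteq> X" "finite Z'"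
  shows "elem_step G C S (Q Z) (sigma G Z Z')"
proof -
  have "Z \<subseteq> X" "finite Z" "Z' \<noteq> {}"
    using assms finite_subset[of Z Z'] by auto
  then have "Z \<in> ZZ G C" "Z' \<in> ZZ G C" "Z \<notin> sep_fin G C"
    using assms ZZ_infinite subset_infinite_notin_S by metis+
  then show ?thesis
    using assms(4) by (auto simp: elem_step_def)
qed

lemma elem_step_QE:
  assumes "elem_step G C S (Q Z) w"
  obtains X Z' where "X \<in> sep_all G C" "X \<notin> sep_fin G C" "Z \<noteq> {}" "Z \<subset> Z'" "Z' \<subseteq> X" "finite Z'"
    "w = sigma G Z Z'"
proof -
  obtain Z' v v' where Z: "v \<in> verts G" "Z \<in> ZZ_at G C v" "Z \<notin> sep_fin G C"
    and Z': "v' \<in> verts G" "Z' \<in> ZZ_at G C v'" "Z \<subset> Z'" "w = sigma G Z Z'"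
    using assms by (auto simp: elem_step_def ZZ_def)
  obtain X where X: "X \<in> sep_all G C" "Z \<subseteq> X" "Z \<noteq> {}" "X \<notin> sep_fin G C"
    using ZZ_at_cases[OF Z(1,2)] Z(3) by metis
  obtain X' where X': "X' \<in> sep_all G C" "Z' \<subseteq> X'" "finite Z'"
    using ZZ_at_cases[OF Z'(1,2)] by metis
  have "X' = X"
    using X X' Z'(3) unique_member[of X' X] by blast
  then show thesis
    using X X' Z' that by blast
qed

abbreviation convertible (infix "\<sim>" 50) where
  "a \<sim> b \<equiv> equivclp (parallel (elem_step G C S)) a b"

text \<open>
  For a subset \<open>Z\<close> of an infinite \<open>X \<in> C\<close>, the generator \<open>q'\<^sub>Z\<close> is unchanged, and the relations
  \<open>v = r(Z) + q'\<^sub>Z\<close> and \<open>q'\<^sub>Z = r(Z' \<setminus> Z) + q'\<^sub>Z\<^sub>'\<close> are literally replacements. For finite \<open>X\<close>, every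
  \<open>r(Z) + q'\<^sub>Z\<close> reduces to the same element \<open>\<rho>(X)\<close>, so the first relation becomes the replacement
  \<open>v \<leadsto> \<rho>(X)\<close> and the second one becomes trivial. Finally \<open>q'\<^sub>X\<close> reduces to \<open>0\<close> for \<open>X \<in> S\<close>.
\<close>

lemma relation_convertible:
  assumes "(a, b) \<in> M_rels G C S"
  shows "reduce a \<sim> reduce b"
proof -
  consider (vertex) v X Z where "v \<in> verts G" "X \<in> C v" "Z \<subseteq> X" "finite Z" "Z \<noteq> {}"
      "a = {#Vert v#}" "b = range_sum G Z + {#Q Z#}"
    | (enlarge) X Z1 Z2 where "X \<in> sep_all G C" "Z1 \<noteq> {}" "Z1 \<subset> Z2" "Z2 \<subseteq> X" "finite Z2"
      "a = {#Q Z1#}" "b = range_sum G (Z2 - Z1) + {#Q Z2#}"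
    | (kill) X where "X \<in> S" "a = {#Q X#}" "b = {#}"
    using assms unfolding M_rels_def by blast
  then show ?thesis
  proof cases
    case vertex
    have X: "X \<in> sep_all G C"
      using vertex by (auto simp: sep_all_def)
    \<comment> \<open>\<open>Y\<close> is \<open>X\<close> if \<open>X\<close> is finite, and \<open>Z\<close> otherwise\<close>
    have "\<exists>Y\<in>ZZ_at G C v. reduce b = rho G S Y"
    proof (cases "X \<in> sep_fin G C")
      case True
      then have "finite X" by (simp add: sep_fin_def)
      then have "reduce b = rho G S X"
        using vertex(5,7) reduce_gen_finite[OF True vertex(3)]
          range_sum_diff_empty[OF _ vertex(3), symmetric]
        by (simp add: rho_residue ac_simps del: reduce_gen.simps)
      then show ?thesis
        using vertex True ZZ_at_fin by blast
    next
      case False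
      then have "reduce b = rho G S Z"
        using vertex reduce_gen_infinite[OF X False] subset_infinite_notin_S[OF X False]
        by (simp add: rho_def del: reduce_gen.simps)
      then show ?thesis
        using vertex False ZZ_at_infinite by blast
    qed
    then obtain Y where "Y \<in> ZZ_at G C v" "reduce b = rho G S Y"
      by blast
    then have "parallel (elem_step G C S) (reduce a) (reduce b)"
      using vertex(1,6) by (simp add: parallel_gen elem_step_Vert)
    then show ?thesis
      by (rule r_into_equivclp)
  next
    case enlarge
    then have sub: "Z1 \<subseteq> X" "Z1 \<subseteq> Z2" "Z2 \<noteq> {}" by auto
    show ?thesis
    proof (cases "X \<in> sep_fin G C")
      case True
      then have "finite X" by (simp add: sep_fin_def)
      then have "reduce a = reduce b"
        using enlarge(2,6,7) sub(3) reduce_gen_finite[OF True sub(1)]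
          reduce_gen_finite[OF True enlarge(4)] range_sum_diff[OF _ sub(2) enlarge(4), symmetric]
        by (simp add: ac_simps del: reduce_gen.simps)
      then show ?thesis by simp
    next
      case False
      then have "reduce a = {#Q Z1#}" "reduce b = sigma G Z1 Z2"
        using enlarge sub reduce_gen_infinite[OF enlarge(1) False]
        by (simp_all add: sigma_def del: reduce_gen.simps)
      then show ?thesis
        using elem_step_Q[OF enlarge(1) False enlarge(2-5)]
        by (simp add: parallel_gen r_into_equivclp)
    qed
  next
    case kill
    then have X: "X \<in> sep_fin G C" using S_sub by blast
    then obtain v where "v \<in> verts G" "X \<in> C v" by (auto simp: sep_fin_def sep_all_def)
    then have "X \<noteq> {}" using member_C(2) by blast
    then have "reduce a = {#}"
      using kill reduce_gen_finite[OF X, of X]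
      by (simp add: residue_def range_sum_def del: reduce_gen.simps)
    then show ?thesis using kill by simp
  qed
qed

lemma cong_imp_convertible:
  assumes "a \<approx> b"
  shows "reduce a \<sim> reduce b"
  using assms
proof (induction rule: presented_cong.induct)
  case (rel a b)
  then show ?case by (simp add: relation_convertible)
next
  case (sym a b)
  then show ?case by (simp add: equivclp_sym)
next
  case (trans a b c)
  then show ?case by (meson transp_equivclp transpD)
next
  case (add a b c)
  then show ?case by (simp add: parallel_convertible_add)
qed simp


section \<open>Reductions and replacements respect the congruence\<close>

lemma S_cong:
  assumes "X \<in> S"
  shows "{#Q X#} \<approx> {#}"
proof (rule presented_cong.rel)
  have X: "X \<in> sep_all G C" "finite X"
    using assms S_sub by (auto simp: sep_fin_def)
  moreover from X have "X \<noteq> {}"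
    using member_C(2) by (auto simp: sep_all_def)
  ultimately show "{#Q X#} \<in> free_carrier (M_gens G C)"
    by (auto intro: Q_in_gens)
qed (use assms in \<open>auto simp: M_rels_def\<close>)

lemma Q_cong_residue:
  assumes "X \<in> sep_all G C" "Z \<subseteq> X" "finite Z" "Z \<noteq> {}"
  shows "{#Q Z#} \<approx> residue Z"
  using assms S_cong by (auto simp: residue_def intro!: presented_cong.refl Q_in_gens)

lemma range_sum_Q_in_free:
  assumes "X \<in> sep_all G C" "Z \<subseteq> X" "finite Z" "Z \<noteq> {}" "Y \<subseteq> X"
  shows "range_sum G Y + {#Q Z#} \<in> free_carrier (M_gens G C)"
  using assms range_sum_in_free Q_in_gens by simp

lemma Vert_cong_rho:
  assumes "v \<in> verts G" "Z \<in> ZZ_at G C v"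
  shows "{#Vert v#} \<approx> rho G S Z"
proof -
  obtain X where X: "X \<in> C v" "X \<in> sep_all G C" "Z \<subseteq> X" "finite Z" "Z \<noteq> {}"
    using ZZ_at_cases[OF assms] by metis
  have "{#Vert v#} \<approx> range_sum G Z + {#Q Z#}"
    by (rule presented_cong.rel)
      (use assms(1) X range_sum_Q_in_free[OF X(2-5,3)] in \<open>auto simp: M_rels_def M_gens_def\<close>)
  moreover have "range_sum G Z + {#Q Z#} \<approx> rho G S Z"
    unfolding rho_residue using X
    by (intro presented_cong_plus presented_cong.refl range_sum_in_free Q_cong_residue)
  ultimately show ?thesis
    by (rule presented_cong.trans)
qed

lemma Q_cong_sigma:
  assumes "X \<in> sep_all G C" "Z \<noteq> {}" "Z \<subset> Z'" "Z' \<subseteq> X" "finite Z'"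
  shows "{#Q Z#} \<approx> sigma G Z Z'"
proof (rule presented_cong.rel)
  have sub: "Z \<subseteq> X" "finite Z" "Z' \<noteq> {}" "Z' - Z \<subseteq> X"
    using assms finite_subset[of Z Z'] by auto
  show "({#Q Z#}, sigma G Z Z') \<in> M_rels G C S"
    using assms unfolding M_rels_def sigma_def by blast
  show "{#Q Z#} \<in> free_carrier (M_gens G C)"
    using assms sub Q_in_gens by simp
  show "sigma G Z Z' \<in> free_carrier (M_gens G C)"
    unfolding sigma_def using assms sub by (intro range_sum_Q_in_free)
qed

lemma elem_step_cong:
  assumes "elem_step G C S u w"
  shows "{#u#} \<approx> w"
proof (cases u)
  case (Vert v)
  then show ?thesis
    using assms Vert_cong_rho by (auto simp: elem_step_def)
next
  case (Q Z)
  with assms show ?thesis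
    by (auto elim!: elem_step_QE intro: Q_cong_sigma)
qed

lemma parallel_cong:
  assumes "parallel (elem_step G C S) a b" "a \<in> free_carrier (M_gens G C)"
  shows "a \<approx> b"
  using assms
proof (induction rule: parallel.induct)
  case empty
  then show ?case by (simp add: presented_cong.refl)
next
  case (keep a b u)
  then have "{#u#} + a \<approx> {#u#} + b"
    by (intro presented_cong_plus presented_cong.refl) auto
  then show ?case by simp
next
  case (replace u w a b)
  then have "{#u#} + a \<approx> w + b"
    by (intro presented_cong_plus elem_step_cong) auto
  then show ?case by simp
qed

lemma parallel_star_cong:
  assumes "(parallel (elem_step G C S))\<^sup>*\<^sup>* a b" "a \<in> free_carrier (M_gens G C)"
  shows "a \<approx> b"
  using assms
proof (induction rule: rtranclp_induct)
  case base
  then show ?case by (rule presented_cong.refl)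
next
  case (step b c)
  then have "a \<approx> b" by blast
  moreover from this step.hyps(2) have "b \<approx> c"
    by (blast intro: parallel_cong dest: presented_cong_carrier)
  ultimately show ?case by (rule presented_cong.trans)
qed

text \<open>
  The substitution is the relation that enlarges \<open>Z\<close> to \<open>X\<close>, followed by \<open>q'\<^sub>X = 0\<close> if \<open>X \<in> S\<close>. For
  \<open>Z = X\<close> the first of these is an identity rather than a defining relation.
\<close>

lemma reduce_gen_cong:
  assumes "u \<in> M_gens G C"
  shows "{#u#} \<approx> reduce_gen u"
proof (cases u)
  case (Vert v)
  with assms show ?thesis by (simp add: presented_cong.refl)
next
  case (Q Z)
  with assms obtain X where X: "X \<in> sep_all G C" "Z \<subseteq> X" "finite Z" "Z \<noteq> {}"
    by (auto simp: M_gens_def)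
  show ?thesis
  proof (cases "X \<in> sep_fin G C")
    case False
    then show ?thesis
      using Q assms reduce_gen_infinite[OF X(1) False X(2,4)]
      by (simp add: presented_cong.refl del: reduce_gen.simps)
  next
    case True
    then have "finite X" by (simp add: sep_fin_def)
    have "{#Q Z#} \<approx> range_sum G (X - Z) + {#Q X#}"
    proof (cases "Z = X")
      case True
      then show ?thesis
        using X Q_in_gens[OF X] by (simp add: range_sum_def presented_cong.refl)
    next
      case False
      then show ?thesis
        using Q_cong_sigma[of X Z X] X \<open>finite X\<close> by (auto simp: sigma_def)
    qed
    moreover have "range_sum G (X - Z) + {#Q X#} \<approx> range_sum G (X - Z) + residue X"
      using X \<open>finite X\<close>
      by (intro presented_cong_plus presented_cong.refl range_sum_in_free Q_cong_residue) auto
    ultimately show ?thesis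
      unfolding Q reduce_gen_finite[OF True X(2,4)] by (rule presented_cong.trans)
  qed
qed

lemma reduce_cong:
  assumes "a \<in> free_carrier (M_gens G C)"
  shows "a \<approx> reduce a"
  using assms
proof (induction a)
  case empty
  then show ?case by (simp add: presented_cong.refl)
next
  case (add u a)
  then have "{#u#} + a \<approx> reduce_gen u + reduce a"
    by (intro presented_cong_plus reduce_gen_cong) auto
  then show ?case by simp
qed


section \<open>Joining replacements of one generator\<close>

text \<open>
  Enlarging \<open>Y\<close> inside a sum. The parameter \<open>W\<close> serves both kinds of replacement: \<open>W = {}\<close> gives
  \<open>\<rho>(Y) \<leadsto>\<^sub>1 \<rho>(Z)\<close>, and nonempty \<open>W\<close> gives \<open>\<sigma>(W,Y) \<leadsto>\<^sub>1 \<sigma>(W,Z)\<close>.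
\<close>

lemma range_sum_enlarge:
  assumes "X \<in> sep_all G C" "X \<notin> sep_fin G C" "Y \<noteq> {}" "W \<subseteq> Y" "Y \<subseteq> Z" "Z \<subseteq> X" "finite Z"
  shows "parallel (elem_step G C S) (range_sum G (Y - W) + {#Q Y#}) (range_sum G (Z - W) + {#Q Z#})"
proof (cases "Y = Z")
  case True
  then show ?thesis by (simp add: parallel_refl)
next
  case False
  then have "parallel (elem_step G C S) {#Q Y#} (range_sum G (Z - Y) + {#Q Z#})"
    using elem_step_Q[of X Y Z] assms by (auto simp: sigma_def intro: parallel_gen)
  then have "parallel (elem_step G C S) (range_sum G (Y - W) + {#Q Y#})
      (range_sum G (Y - W) + (range_sum G (Z - Y) + {#Q Z#}))"
    by (intro parallel_add parallel_refl)
  then show ?thesis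
    using range_sum_diff[OF assms(7,4,5)] by (simp flip: add.assoc)
qed

text \<open>
  If \<open>X \<union> Y\<close> lies in a member \<open>W\<close> of \<open>C\<close>, then so do \<open>X\<close> and \<open>Y\<close>; when \<open>W\<close> is finite, the only
  available set inside it is \<open>W\<close> itself.
\<close>

lemma union_in_ZZ_at:
  assumes "v \<in> verts G" "X \<in> ZZ_at G C v" "Y \<in> ZZ_at G C v" "X \<union> Y \<in> ZZ_at G C v"
  obtains "X = Y" | W where "W \<in> sep_all G C" "W \<notin> sep_fin G C" "X \<union> Y \<subseteq> W"
proof -
  obtain A where A: "A \<in> sep_all G C" "X \<subseteq> A" "X \<noteq> {}" "A \<in> sep_fin G C \<longrightarrow> X = A"
    using ZZ_at_cases[OF assms(1,2)] by metis
  obtain B where B: "B \<in> sep_all G C" "Y \<subseteq> B" "Y \<noteq> {}" "B \<in> sep_fin G C \<longrightarrow> Y = B"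
    using ZZ_at_cases[OF assms(1,3)] by metis
  obtain W where W: "W \<in> sep_all G C" "X \<union> Y \<subseteq> W"
    using ZZ_at_cases[OF assms(1,4)] by metis
  obtain x y where "x \<in> X" "y \<in> Y"
    using A(3) B(3) by blast
  then have "A = W" "B = W"
    using A B W unique_member[of A W x] unique_member[of B W y] by auto
  then show thesis
    using A B W(2) that(1) that(2)[of W] by (cases "W \<in> sep_fin G C") auto
qed

text \<open>
  Assumption (*) supplies the common element for a vertex and sets \<open>X\<close>, \<open>Y\<close> whose union is not
  available at it. In all other cases both replacements either agree or use subsets of one infinite member of \<open>C\<close>, and
  enlarging both subsets to their union yields the same element.
\<close>

lemma elem_step_joinable:
  assumes star: "assumption_star G C S"
    and steps: "elem_step G C S u w1" "elem_step G C S u w2"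
  shows "\<exists>w. parallel (elem_step G C S) w1 w \<and> parallel (elem_step G C S) w2 w"
proof (cases u)
  case (Vert v)
  then obtain X Y where v: "v \<in> verts G" and X: "X \<in> ZZ_at G C v" "w1 = rho G S X"
    and Y: "Y \<in> ZZ_at G C v" "w2 = rho G S Y"
    using steps by (auto simp: elem_step_def)
  show ?thesis
  proof (cases "X \<union> Y \<in> ZZ_at G C v")
    case False
    then show ?thesis
      using star v X Y leadsto1_imp_parallel unfolding assumption_star_def by blast
  next
    case True
    from v X(1) Y(1) True show ?thesis
    proof (cases rule: union_in_ZZ_at)
      case 1
      then show ?thesis using X Y parallel_refl by blast
    next
      case (2 W)
      have ne: "X \<noteq> {}" "Y \<noteq> {}" "finite (X \<union> Y)"
        using ZZ_at_cases[OF v X(1)] ZZ_at_cases[OF v Y(1)] by (metis finite_UnI)+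
      then have "w1 = range_sum G (X - {}) + {#Q X#}" "w2 = range_sum G (Y - {}) + {#Q Y#}"
        using X Y 2 subset_infinite_notin_S(2)[OF 2(1,2)] by (auto simp: rho_def)
      then show ?thesis
        using range_sum_enlarge[OF 2(1,2) ne(1), of "{}" "X \<union> Y"]
          range_sum_enlarge[OF 2(1,2) ne(2), of "{}" "X \<union> Y"] 2(3) ne(3)
        by auto
    qed
  qed
next
  case (Q Z)
  obtain X Z1 where 1: "X \<in> sep_all G C" "X \<notin> sep_fin G C" "Z \<noteq> {}" "Z \<subset> Z1" "Z1 \<subseteq> X" "finite Z1"
    "w1 = sigma G Z Z1"
    using steps(1) unfolding Q by (rule elem_step_QE)
  obtain Y Z2 where 2: "Y \<in> sep_all G C" "Z \<subset> Z2" "Z2 \<subseteq> Y" "finite Z2" "w2 = sigma G Z Z2"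
    using steps(2) unfolding Q by (rule elem_step_QE)
  have "Y = X"
    using 1 2 unique_member[of Y X] by blast
  have sub: "Z1 \<noteq> {}" "Z \<subseteq> Z1" "Z2 \<noteq> {}" "Z \<subseteq> Z2" "Z1 \<union> Z2 \<subseteq> X" "finite (Z1 \<union> Z2)"
    using 1 2 \<open>Y = X\<close> by auto
  then show ?thesis
    unfolding 1(7) 2(5) sigma_def
    using range_sum_enlarge[OF 1(1,2) sub(1,2) _ sub(5,6)]
      range_sum_enlarge[OF 1(1,2) sub(3,4) _ sub(5,6)] by blast
qed

end


section \<open>Refinement\<close>

theorem theorem5p15:
  fixes G :: "('v, 'e) pre_digraph"
    and C :: "'v \<Rightarrow> 'e set set"
    and S :: "'e set set"
  assumes "separated_graph G C"
    and "S \<subseteq> sep_fin G C"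
    and "assumption_star G C S"
  shows "refinement_monoid (M_monoid G C S)"
  unfolding M_monoid_def
proof (rule refinement_monoid_presented_monoid)
  interpret finitely_marked_separated_graph G C S
    using assms(1,2)
    by (simp add: finitely_marked_separated_graph_def finitely_marked_separated_graph_axioms_def)
  let ?R = "(parallel (elem_step G C S))\<^sup>*\<^sup>*"
  fix a b c d
  assume "a + b \<approx> c + d"
  then have "reduce a + reduce b \<sim> reduce c + reduce d"
    and car: "a \<in> free_carrier (M_gens G C)" "b \<in> free_carrier (M_gens G C)"
      "c \<in> free_carrier (M_gens G C)" "d \<in> free_carrier (M_gens G C)"
    using cong_imp_convertible by (fastforce dest: presented_cong_carrier)+
  then obtain e where e: "?R (reduce a + reduce b) e" "?R (reduce c + reduce d) e"
    using parallel_church_rosser elem_step_joinable[OF assms(3)] by metis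
  obtain a' b' where ab: "e = a' + b'" "?R (reduce a) a'" "?R (reduce b) b'"
    using parallel_star_split[OF e(1)] by blast
  obtain c' d' where cd: "e = c' + d'" "?R (reduce c) c'" "?R (reduce d) d'"
    using parallel_star_split[OF e(2)] by blast
  have descend: "p \<approx> p'" if "p \<in> free_carrier (M_gens G C)" "?R (reduce p) p'" for p p'
    using reduce_cong[OF that(1)] parallel_star_cong[OF that(2)]
    by (blast intro: presented_cong.trans dest: presented_cong_carrier)
  obtain x y z t where "a' = x + y" "b' = z + t" "c' = x + z" "d' = y + t"
    using multiset_refinement[of a' b' c' d'] ab(1) cd(1) by metis
  then show "\<exists>x y z t. a \<approx> x + y \<and> b \<approx> z + t \<and> c \<approx> x + z \<and> d \<approx> y + t"
    using descend car ab cd by blast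
qed

end
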